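(* Suppose $\operatorname{rank}(C)=N_2$ and $|\operatorname{supp}(s_i)|=N_2$ for every $s_i\in\mathcal S$. Let Algorithm EPG-V (defined in the context) be run with $\varepsilon_{\mathrm{aud}}=0$ on a decision $x_1$ and a nonempty set $\mathcal S'\subseteq\mathcal S$ output by Algorithm EPG-O, with every audit and every recourse-dual linear program solved exactly. Then Algorithm EPG-V terminates finitely, and its returned set $\mathcal S_{\mathrm{val}}$ is value-complete at $x_1$ in the sense that $$\max_{s\in\mathcal S_{\mathrm{val}}}d(\xi,x_1)^\top s=\psi(x_1,\xi),\qquad\forall\xi\in\Xi.$$
   Context: Setting. $\Xi\subseteq\mathbb R^{N_\xi}$ is a compact uncertainty set, $C\in\mathbb R^{M\times N_2}$ with $M\ge N_2$, $b\in\mathbb R^{N_2}$, and $B,W,w,A,a,c$ are fixed data of compatible dimensions; $x_1\in\mathbb R^{N_1}$, $x_2\in\mathbb R^{N_2}$. Put $d(\xi,x_1)=W\xi+w-Bx_1\in\mathbb R^M$. The recourse value is $\psi(x_1,\xi)=\min_{x_2}\{b^\top x_2\mid Cx_2\ge d(\xi,x_1)\}$. The dual polyhedron $\mathcal Z=\{z\in\mathbb R^M\mid C^\top z=b,\ z\ge 0\}$ is assumed nonempty; $\mathcal S=\{s_1,\dots,s_S\}$ is its finite set of extreme points (vertices), and $\mathcal R$ is the finite set of extreme rays of its recession cone. The first-stage feasible region is $$\mathcal X_1=\{x_1: Ax_1\ge a,\ \sup_{\xi\in\Xi}d(\xi,x_1)^\top r\le 0\ \ \forall r\in\mathcal R\}.$$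 For $x_1\in\mathcal X_1$, $\psi(x_1,\xi)=\max_{s\in\mathcal S}d(\xi,x_1)^\top s$ for all $\xi\in\Xi$. $\Theta\subseteq\mathbb R^{N_\theta}$, $\phi_0:\Theta\to\mathbb R$ and $\phi_\ell:\Theta\times\Xi\to\mathbb R$ ($\ell\in[L]$) are given. The full master problem is $$\min_{x_1\in\mathcal X_1,\theta\in\Theta}\ c^\top x_1+\phi_0(\theta)\quad\text{s.t.}\quad \phi_\ell(\theta,\xi)\ge d(\xi,x_1)^\top s\ \ \forall\xi\in\Xi,\ s\in\mathcal S,\ \ell\in[L],$$ assumed to have a finite, attained optimal value. $\operatorname{supp}(v)$ is the index set of nonzero components; $v_{\mathcal J}$ and $C_{\mathcal J}$ are the subvector and row submatrix indexed by $\mathcal J$; $C_k$ is the $k$-th row of $C$. Algorithm EPG-O. The RMP for $\mathcal S_t\subseteq\mathcal S$ is the full master with $\mathcal S$ replaced by $\mathcal S_t$. Exact separation at $(x_1^{(t)},\theta^{(t)})$ computes $V^{(t)}=\max_{\ell\in[L]}\max_{\xi\in\Xi,z\in\mathcal Z}[d(\xi,x_1^{(t)})^\top z-\phi_\ell(\theta^{(t)},\xi)]$; approximate separation computes $V'^{(t)}$ by the same formula with $\Xi$ replaced by a finite set $\Xi^{(t)}\subseteq\Xi$ of candidate worst-case scenarios from the current RMP. Input: a nonempty seed $\mathcal S_1\subseteq\mathcal S$ and tolerances $\varepsilon_{\mathrm{disc}},\varepsilon_{\mathrm{obj}}\ge0$. Starting from $t=1$, repeat: solve the RMP for $\mathcal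 S_t$ to get $(x_1^{(t)},\theta^{(t)})$ (so $x_1^{(t)}\in\mathcal X_1$); solve approximate separation, obtaining a maximizing vertex $\hat s^{(t)}$; if $V'^{(t)}>\varepsilon_{\mathrm{disc}}$ set $s^\star=\hat s^{(t)}$; otherwise solve exact separation, obtaining a maximizing vertex $s^\star$, and if $V^{(t)}\le\varepsilon_{\mathrm{obj}}$, delete vertices from $\mathcal S_t$ until no further deletion preserves the RMP value, giving $\mathcal S_{\mathrm{obj}}$, return $(x_1^{(t)},\theta^{(t)},\mathcal S_{\mathrm{obj}})$ and stop; finally set $\mathcal S_{t+1}=\mathcal S_t\cup\{s^\star\}$, $t\leftarrow t+1$. Algorithm EPG-V (at the fixed decision $x_1$). For $s_i\in\mathcal S$ let $\mathcal J_i=\operatorname{supp}(s_i)$ and $x_{2,i}(\xi)=C_{\mathcal J_i}^{-1}d_{\mathcal J_i}(\xi,x_1)$. For nonempty $\mathcal T\subseteq\mathcal S$ and $s_i\in\mathcal T$, the dominance cell is $$\widehat{\mathcal R}_i(\mathcal T)=\{\xi\in\Xi:\ d(\xi,x_1)^\top s_i\ge d(\xi,x_1)^\top s_j\ \ \forall s_j\in\mathcal T\},$$ and for each nonempty cell and each $k\in[M]\setminus\mathcal J_i$ the audit is $$\Delta_{ik}(\mathcal T)=\max_{\xi\in\widehat{\mathcal R}_i(\mathcal T)}\{d_k(\xi,x_1)-C_kx_{2,i}(\xi)\}.$$ Input: the EPG-O decision $x_1$, a nonempty EPG-O output set $\mathcal S'\subseteq\mathcal S$, and $\varepsilon_{\mathrm{aud}}\ge0$.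 Initialize $\mathcal S_{\mathrm{val}}=\mathcal S'$ and solve all audits for nonempty cells. While some $\Delta_{ik}(\mathcal S_{\mathrm{val}})>\varepsilon_{\mathrm{aud}}$: choose such a pair $(i,k)$ and a maximizing witness $\hat\xi\in\widehat{\mathcal R}_i(\mathcal S_{\mathrm{val}})$; solve the recourse-dual linear program $\max_{z\in\mathcal Z}d(\hat\xi,x_1)^\top z$ to obtain an optimal extreme point $s^{\mathrm{new}}\in\mathcal S$; replace $\mathcal S_{\mathrm{val}}$ by $\mathcal S_{\mathrm{val}}\cup\{s^{\mathrm{new}}\}$; recompute all nonempty cells and audits. After the loop, prune $\mathcal S_{\mathrm{val}}$ by deleting the extreme points whose dominance cell $\widehat{\mathcal R}_i(\mathcal S_{\mathrm{val}})$ has empty relative interior in $\Xi$ (empty interior in the subspace topology of $\Xi$), and return $\mathcal S_{\mathrm{val}}$. *)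

theory Defs
  imports "HOL-Analysis.Analysis"
begin

text \<open>
  Data of a two-stage robust linear program with the master objective and the epigraph functions
  \<open>\<phi>\<^sub>0\<close>, \<open>\<phi>\<^sub>\<ell>\<close>. The fields \<open>recC\<close>, \<open>recb\<close>, \<open>tecB\<close>, \<open>uncW\<close>, \<open>uncw\<close>, \<open>fsA\<close>, \<open>fsa\<close>, \<open>fsc\<close> hold
  \<open>C\<close>, \<open>b\<close>, \<open>B\<close>, \<open>W\<close>, \<open>w\<close>, \<open>A\<close>, \<open>a\<close>, \<open>c\<close>. The index types stand for the
  dimensions: \<open>'k\<close> for \<open>N\<^sub>\<xi>\<close>, \<open>'p\<close> for \<open>N\<^sub>1\<close>, \<open>'n\<close> for \<open>N\<^sub>2\<close>, \<open>'m\<close> for \<open>M\<close>,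
  \<open>'q\<close> for the number of rows of \<open>A\<close>, \<open>'t\<close> for \<open>N\<^sub>\<theta>\<close>. The values of \<open>phi0\<close> outside
  \<open>Theta\<close>, and of \<open>phi\<close> outside \<open>Theta\<close>, \<open>Xi\<close> and the indices \<open>1..nphi\<close>, are never used.
\<close>

record ('k::finite, 'p::finite, 'n::finite, 'm::finite, 'q::finite, 't::finite) epg_data =
  Xi :: "(real^'k) set"
  recC :: "real^'n^'m"
  recb :: "real^'n"
  tecB :: "real^'p^'m"
  uncW :: "real^'k^'m"
  uncw :: "real^'m"
  fsA :: "real^'p^'q"
  fsa :: "real^'q"
  fsc :: "real^'p"
  Theta :: "(real^'t) set"
  phi0 :: "real^'t \<Rightarrow> real"
  nphi :: nat
  phi :: "nat \<Rightarrow> real^'t \<Rightarrow> real^'k \<Rightarrow> real"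

definition rhs :: "('k::finite, 'p::finite, 'n::finite, 'm::finite, 'q::finite, 't::finite) epg_data
    \<Rightarrow> real^'k \<Rightarrow> real^'p \<Rightarrow> real^'m" where
  "rhs D \<xi> x1 = uncW D *v \<xi> + uncw D - tecB D *v x1"

definition recourse_value ::
  "('k::finite, 'p::finite, 'n::finite, 'm::finite, 'q::finite, 't::finite) epg_data
    \<Rightarrow> real^'p \<Rightarrow> real^'k \<Rightarrow> real" where
  "recourse_value D x1 \<xi> = (LEAST v. \<exists>x2. recC D *v x2 \<ge> rhs D \<xi> x1 \<and> v = recb D \<bullet> x2)"

definition dual_poly ::
  "('k::finite, 'p::finite, 'n::finite, 'm::finite, 'q::finite, 't::finite) epg_data
    \<Rightarrow> (real^'m) set" where
  "dual_poly D = {z. transpose (recC D) *v z = recb D \<and> z \<ge> 0}"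

definition dual_vertices ::
  "('k::finite, 'p::finite, 'n::finite, 'm::finite, 'q::finite, 't::finite) epg_data
    \<Rightarrow> (real^'m) set" where
  "dual_vertices D = {s. s extreme_point_of dual_poly D}"

definition recession_cone :: "'a::real_vector set \<Rightarrow> 'a set" where
  "recession_cone Z = {r. \<forall>z\<in>Z. \<forall>t\<ge>0. z + t *\<^sub>R r \<in> Z}"

text \<open>Every extreme ray is represented by its generator of norm 1.\<close>

definition extreme_rays :: "'a::real_normed_vector set \<Rightarrow> 'a set" where
  "extreme_rays K = {r. norm r = 1 \<and> {t *\<^sub>R r | t. t \<ge> 0} face_of K}"

definition dual_rays ::
  "('k::finite, 'p::finite, 'n::finite, 'm::finite, 'q::finite, 't::finite) epg_data
    \<Rightarrow> (real^'m) set" where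
  "dual_rays D = extreme_rays (recession_cone (dual_poly D))"

definition first_stage ::
  "('k::finite, 'p::finite, 'n::finite, 'm::finite, 'q::finite, 't::finite) epg_data
    \<Rightarrow> (real^'p) set" where
  "first_stage D = {x1. fsA D *v x1 \<ge> fsa D \<and>
     (\<forall>r\<in>dual_rays D. (SUP \<xi>\<in>Xi D. ereal (rhs D \<xi> x1 \<bullet> r)) \<le> 0)}"

definition supp :: "real^'m \<Rightarrow> 'm::finite set" where
  "supp v = {k. v $ k \<noteq> 0}"


subsection \<open>Restricted master problems\<close>

text \<open>The master problem for a set \<open>T\<close> of vertices; \<open>T = dual_vertices D\<close> gives the full master.\<close>

definition master_feasible ::
  "('k::finite, 'p::finite, 'n::finite, 'm::finite, 'q::finite, 't::finite) epg_data
    \<Rightarrow> (real^'m) set \<Rightarrow> ((real^'p) \<times> (real^'t)) set" where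
  "master_feasible D T = {(x1, \<theta>). x1 \<in> first_stage D \<and> \<theta> \<in> Theta D \<and>
     (\<forall>\<xi>\<in>Xi D. \<forall>s\<in>T. \<forall>l\<in>{1..nphi D}. phi D l \<theta> \<xi> \<ge> rhs D \<xi> x1 \<bullet> s)}"

definition master_obj ::
  "('k::finite, 'p::finite, 'n::finite, 'm::finite, 'q::finite, 't::finite) epg_data
    \<Rightarrow> ((real^'p) \<times> (real^'t)) \<Rightarrow> real" where
  "master_obj D = (\<lambda>(x1, \<theta>). fsc D \<bullet> x1 + phi0 D \<theta>)"

definition master_solution ::
  "('k::finite, 'p::finite, 'n::finite, 'm::finite, 'q::finite, 't::finite) epg_data
    \<Rightarrow> (real^'m) set \<Rightarrow> ((real^'p) \<times> (real^'t)) \<Rightarrow> bool" where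
  "master_solution D T = is_arg_min (master_obj D) (\<lambda>y. y \<in> master_feasible D T)"

text \<open>Extended-real valued, since deleting vertices can make a restricted master unbounded.\<close>

definition master_value ::
  "('k::finite, 'p::finite, 'n::finite, 'm::finite, 'q::finite, 't::finite) epg_data
    \<Rightarrow> (real^'m) set \<Rightarrow> ereal" where
  "master_value D T = (INF y\<in>master_feasible D T. ereal (master_obj D y))"


subsection \<open>Algorithm EPG-O\<close>

definition violation ::
  "('k::finite, 'p::finite, 'n::finite, 'm::finite, 'q::finite, 't::finite) epg_data
    \<Rightarrow> ((real^'p) \<times> (real^'t)) \<Rightarrow> nat \<times> (real^'k) \<times> (real^'m) \<Rightarrow> real" where
  "violation D = (\<lambda>(x1, \<theta>) (l, \<xi>, z). rhs D \<xi> x1 \<bullet> z - phi D l \<theta> \<xi>)"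

text \<open>
  Separation over the scenarios in \<open>X\<close>: the maximal violation is attained and equal to \<open>V\<close>, and
  \<open>s\<close> is a maximizing vertex.
\<close>

definition separation ::
  "('k::finite, 'p::finite, 'n::finite, 'm::finite, 'q::finite, 't::finite) epg_data
    \<Rightarrow> (real^'k) set \<Rightarrow> ((real^'p) \<times> (real^'t)) \<Rightarrow> real \<Rightarrow> real^'m \<Rightarrow> bool" where
  "separation D X y V s \<longleftrightarrow> s \<in> dual_vertices D \<and>
     (\<exists>l \<xi>. is_arg_max (violation D y) (\<lambda>u. u \<in> {1..nphi D} \<times> X \<times> dual_poly D) (l, \<xi>, s) \<and>
        V = violation D y (l, \<xi>, s))"

definition approx_separation ::
  "('k::finite, 'p::finite, 'n::finite, 'm::finite, 'q::finite, 't::finite) epg_data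
    \<Rightarrow> ((real^'p) \<times> (real^'t)) \<Rightarrow> real \<Rightarrow> real^'m \<Rightarrow> bool" where
  "approx_separation D y V s \<longleftrightarrow> (\<exists>X. finite X \<and> X \<subseteq> Xi D \<and> separation D X y V s)"

text \<open>The vertex sets \<open>T\<close> that can occur as \<open>\<S>\<^sub>t\<close> in a run with seed \<open>S1\<close>.\<close>

inductive epgo_iterate ::
  "('k::finite, 'p::finite, 'n::finite, 'm::finite, 'q::finite, 't::finite) epg_data
    \<Rightarrow> real \<Rightarrow> real \<Rightarrow> (real^'m) set \<Rightarrow> (real^'m) set \<Rightarrow> bool"
  for D \<epsilon>disc \<epsilon>obj S1 where
  seed: "epgo_iterate D \<epsilon>disc \<epsilon>obj S1 S1"
| approx_cut: "epgo_iterate D \<epsilon>disc \<epsilon>obj S1 (insert s T)"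
    if "epgo_iterate D \<epsilon>disc \<epsilon>obj S1 T" "master_solution D T y"
       "approx_separation D y V' s" "V' > \<epsilon>disc"
| exact_cut: "epgo_iterate D \<epsilon>disc \<epsilon>obj S1 (insert s T)"
    if "epgo_iterate D \<epsilon>disc \<epsilon>obj S1 T" "master_solution D T y"
       "approx_separation D y V' s'" "V' \<le> \<epsilon>disc"
       "separation D (Xi D) y V s" "V > \<epsilon>obj"

definition deletion ::
  "('k::finite, 'p::finite, 'n::finite, 'm::finite, 'q::finite, 't::finite) epg_data
    \<Rightarrow> (real^'m) set \<Rightarrow> (real^'m) set \<Rightarrow> bool" where
  "deletion D T T' \<longleftrightarrow> (\<exists>s\<in>T. T' = T - {s}) \<and> master_value D T' = master_value D T"

definition epgo_output ::
  "('k::finite, 'p::finite, 'n::finite, 'm::finite, 'q::finite, 't::finite) epg_data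
    \<Rightarrow> real \<Rightarrow> real \<Rightarrow> (real^'m) set \<Rightarrow> real^'p \<Rightarrow> real^'t \<Rightarrow> (real^'m) set \<Rightarrow> bool" where
  "epgo_output D \<epsilon>disc \<epsilon>obj S1 x1 \<theta> Sobj \<longleftrightarrow>
     (\<exists>T V' s' V s. epgo_iterate D \<epsilon>disc \<epsilon>obj S1 T \<and> master_solution D T (x1, \<theta>) \<and>
        approx_separation D (x1, \<theta>) V' s' \<and> V' \<le> \<epsilon>disc \<and>
        separation D (Xi D) (x1, \<theta>) V s \<and> V \<le> \<epsilon>obj \<and>
        (deletion D)\<^sup>*\<^sup>* T Sobj \<and> \<not> (\<exists>T'. deletion D Sobj T'))"


subsection \<open>Algorithm EPG-V\<close>

text \<open>
  For \<open>card J = CARD('n)\<close> the row submatrix \<open>C\<^sub>J\<close> is square; its rows are indexed by \<open>'n\<close>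
  through a bijection onto \<open>J\<close>, and the same bijection is used for \<open>v\<^sub>J\<close>, so that \<open>basic_sol\<close>
  does not depend on its choice.
\<close>

definition row_enum :: "'m set \<Rightarrow> 'n::finite \<Rightarrow> 'm" where
  "row_enum J = (SOME \<sigma>. bij_betw \<sigma> UNIV J)"

definition row_submatrix :: "real^'n^'m::finite \<Rightarrow> 'm set \<Rightarrow> real^'n^'n::finite" where
  "row_submatrix C J = (\<chi> i. C $ row_enum J i)"

definition subvector :: "real^'m::finite \<Rightarrow> 'm set \<Rightarrow> real^'n::finite" where
  "subvector v J = (\<chi> i. v $ row_enum J i)"

definition basic_sol ::
  "('k::finite, 'p::finite, 'n::finite, 'm::finite, 'q::finite, 't::finite) epg_data
    \<Rightarrow> real^'p \<Rightarrow> real^'m \<Rightarrow> real^'k \<Rightarrow> real^'n" where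
  "basic_sol D x1 s \<xi> =
     matrix_inv (row_submatrix (recC D) (supp s)) *v subvector (rhs D \<xi> x1) (supp s)"

definition cell ::
  "('k::finite, 'p::finite, 'n::finite, 'm::finite, 'q::finite, 't::finite) epg_data
    \<Rightarrow> real^'p \<Rightarrow> (real^'m) set \<Rightarrow> real^'m \<Rightarrow> (real^'k) set" where
  "cell D x1 T s = {\<xi>\<in>Xi D. \<forall>s'\<in>T. rhs D \<xi> x1 \<bullet> s \<ge> rhs D \<xi> x1 \<bullet> s'}"

definition row_excess ::
  "('k::finite, 'p::finite, 'n::finite, 'm::finite, 'q::finite, 't::finite) epg_data
    \<Rightarrow> real^'p \<Rightarrow> real^'m \<Rightarrow> 'm \<Rightarrow> real^'k \<Rightarrow> real" where
  "row_excess D x1 s k \<xi> = rhs D \<xi> x1 $ k - recC D $ k \<bullet> basic_sol D x1 s \<xi>"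

definition audit ::
  "('k::finite, 'p::finite, 'n::finite, 'm::finite, 'q::finite, 't::finite) epg_data
    \<Rightarrow> real^'p \<Rightarrow> (real^'m) set \<Rightarrow> real^'m \<Rightarrow> 'm \<Rightarrow> real" where
  "audit D x1 T s k = (GREATEST v. \<exists>\<xi>\<in>cell D x1 T s. v = row_excess D x1 s k \<xi>)"

definition audit_fails ::
  "('k::finite, 'p::finite, 'n::finite, 'm::finite, 'q::finite, 't::finite) epg_data
    \<Rightarrow> real^'p \<Rightarrow> real \<Rightarrow> (real^'m) set \<Rightarrow> real^'m \<Rightarrow> 'm \<Rightarrow> bool" where
  "audit_fails D x1 \<epsilon>aud T s k \<longleftrightarrow>
     s \<in> T \<and> k \<notin> supp s \<and> cell D x1 T s \<noteq> {} \<and> audit D x1 T s k > \<epsilon>aud"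

text \<open>One pass through the loop body, over all admissible choices of pair, witness and vertex.\<close>

definition epgv_step ::
  "('k::finite, 'p::finite, 'n::finite, 'm::finite, 'q::finite, 't::finite) epg_data
    \<Rightarrow> real^'p \<Rightarrow> real \<Rightarrow> (real^'m) set \<Rightarrow> (real^'m) set \<Rightarrow> bool" where
  "epgv_step D x1 \<epsilon>aud T T' \<longleftrightarrow>
     (\<exists>s k \<xi> snew. audit_fails D x1 \<epsilon>aud T s k \<and>
        is_arg_max (row_excess D x1 s k) (\<lambda>\<xi>. \<xi> \<in> cell D x1 T s) \<xi> \<and>
        snew \<in> dual_vertices D \<and>
        is_arg_max (\<lambda>z. rhs D \<xi> x1 \<bullet> z) (\<lambda>z. z \<in> dual_poly D) snew \<and>
        T' = insert snew T)"

definition prune ::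
  "('k::finite, 'p::finite, 'n::finite, 'm::finite, 'q::finite, 't::finite) epg_data
    \<Rightarrow> real^'p \<Rightarrow> (real^'m) set \<Rightarrow> (real^'m) set" where
  "prune D x1 T = {s\<in>T. top_of_set (Xi D) interior_of cell D x1 T s \<noteq> {}}"

definition epgv_output ::
  "('k::finite, 'p::finite, 'n::finite, 'm::finite, 'q::finite, 't::finite) epg_data
    \<Rightarrow> real^'p \<Rightarrow> real \<Rightarrow> (real^'m) set \<Rightarrow> (real^'m) set \<Rightarrow> bool" where
  "epgv_output D x1 \<epsilon>aud S' Sval \<longleftrightarrow>
     (\<exists>T. (epgv_step D x1 \<epsilon>aud)\<^sup>*\<^sup>* S' T \<and> (\<nexists>s k. audit_fails D x1 \<epsilon>aud T s k) \<and>
        Sval = prune D x1 T)"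

text \<open>
  Whatever choices are made, the loop is not executed infinitely often and never gets stuck:
  as long as some audit fails, a further pass can be carried out.
\<close>

definition epgv_terminates ::
  "('k::finite, 'p::finite, 'n::finite, 'm::finite, 'q::finite, 't::finite) epg_data
    \<Rightarrow> real^'p \<Rightarrow> real \<Rightarrow> (real^'m) set \<Rightarrow> bool" where
  "epgv_terminates D x1 \<epsilon>aud S' \<longleftrightarrow>
     \<not> (\<exists>f. f 0 = S' \<and> (\<forall>n::nat. epgv_step D x1 \<epsilon>aud (f n) (f (Suc n)))) \<and>
     (\<forall>T. (epgv_step D x1 \<epsilon>aud)\<^sup>*\<^sup>* S' T \<longrightarrow> (\<exists>s k. audit_fails D x1 \<epsilon>aud T s k)
        \<longrightarrow> (\<exists>T'. epgv_step D x1 \<epsilon>aud T T'))"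

definition value_complete ::
  "('k::finite, 'p::finite, 'n::finite, 'm::finite, 'q::finite, 't::finite) epg_data
    \<Rightarrow> real^'p \<Rightarrow> (real^'m) set \<Rightarrow> bool" where
  "value_complete D x1 T \<longleftrightarrow>
     (\<forall>\<xi>\<in>Xi D. Max ((\<lambda>s. rhs D \<xi> x1 \<bullet> s) ` T) = recourse_value D x1 \<xi>)"

end

theory Submission
  imports Defs
begin

text \<open>
  Let \<open>d\<close> be the right-hand side in a scenario. A vertex \<open>s\<close> of the dual polyhedron
  with as many nonzero components as \<open>C\<close> has columns is a nondegenerate basis: the rows of
  \<open>C\<close> in its support form an invertible matrix, because a kernel direction on the support would
  contradict extremality (\<open>vertex_kernel_trivial\<close>, \<open>invertible_row_submatrix\<close>). The basic
  recourse solution is then tight on the support and has the value \<open>d \<bullet> s\<close>, and the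
  audited excess of a row outside the support is the reduced profit of that row.

  A positive excess allows a simplex pivot of positive length, so \<open>s\<close> is not dual optimal at the
  witness (\<open>positive_excess_improves\<close>). As \<open>s\<close> dominates all current vertices on its cell,
  none of them is optimal there, and the optimal vertex that the loop adds is new
  (\<open>epgv_step_adds_vertex\<close>). A vertex is determined by its support, so there are only finitely
  many of them and the loop cannot run forever. Nor can it get stuck: the exact separation that
  ended EPG-O has a finite optimal value, so the recourse dual is bounded in every scenario, and
  a bounded objective is maximized at a vertex (\<open>vertex_dominates\<close>).

  If all excesses over a cell are nonpositive, the basic solution is primal feasible there, and weak
  duality identifies \<open>d \<bullet> s\<close> as the recourse value (\<open>recourse_value_eq_vertex_value\<close>).
  The cells cover the uncertainty set, and they still do after those with empty relative
  interior are dropped, since a finite union of closed sets without interior has no interior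
  (\<open>pruned_cells_cover\<close>).
\<close>

section \<open>Support directions of vertices of the dual polyhedron\<close>

lemma mem_dual_poly_iff:
  "z \<in> dual_poly D \<longleftrightarrow> transpose (recC D) *v z = recb D \<and> (\<forall>k. 0 \<le> z $ k)"
  by (auto simp: dual_poly_def less_eq_vec_def)

lemma inner_constraint_dual:
  fixes C :: "real^'n^'m"
  shows "x \<bullet> (transpose C *v z) = (C *v x) \<bullet> z"
  by (metis dot_lmul_matrix inner_commute transpose_matrix_vector)

lemma nonneg_small_step:
  fixes s u :: "real^'m::finite"
  assumes "\<And>k. 0 \<le> s $ k" and "\<And>k. s $ k = 0 \<Longrightarrow> 0 \<le> u $ k"
  shows "\<exists>e>0. \<forall>k. 0 \<le> (s + e *\<^sub>R u) $ k"
proof -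
  have "eventually (\<lambda>t. 0 \<le> (s + t *\<^sub>R u) $ k) (at_right 0)" for k
  proof (cases "s $ k = 0")
    case True
    show ?thesis
      using eventually_at_right_less[of "0::real"]
      by eventually_elim (use True assms(2)[of k] in auto)
  next
    case False
    then have pos: "0 < s $ k" using assms(1)[of k] by simp
    have "((\<lambda>t. s $ k + t * u $ k) \<longlongrightarrow> s $ k + 0 * u $ k) (at_right 0)"
      by (intro tendsto_intros)
    then have "eventually (\<lambda>t. 0 < s $ k + t * u $ k) (at_right 0)"
      using pos by (auto dest: order_tendstoD(1)[where a = 0])
    then show ?thesis by eventually_elim simp
  qed
  then have "eventually (\<lambda>t. \<forall>k. 0 \<le> (s + t *\<^sub>R u) $ k) (at_right 0)"
    by (intro eventually_all_finite) auto
  then have "eventually (\<lambda>t. 0 < t \<and> (\<forall>k. 0 \<le> (s + t *\<^sub>R u) $ k)) (at_right (0::real))"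
    using eventually_at_right_less[of "0::real"] by eventually_elim simp
  then show ?thesis
    by (metis (no_types, lifting) eventually_happens' trivial_limit_at_right_real)
qed

text \<open>
  A kernel direction carried by the support of a vertex could be followed both ways without
  leaving the polyhedron, which would put the vertex inside a segment.
\<close>

lemma vertex_kernel_trivial:
  assumes s: "s \<in> dual_vertices D"
    and ker: "transpose (recC D) *v u = 0" and sub: "supp u \<subseteq> supp s"
  shows "u = 0"
proof (rule ccontr)
  assume u0: "u \<noteq> 0"
  have ext: "s extreme_point_of dual_poly D"
    using s by (simp add: dual_vertices_def)
  then have sP: "s \<in> dual_poly D" by (simp add: extreme_point_of_def)
  have zero: "u $ k = 0" if "s $ k = 0" for k
    using sub that by (auto simp: supp_def)
  obtain e where e: "e > 0" "\<forall>k. 0 \<le> (s + e *\<^sub>R u) $ k"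
    using nonneg_small_step[of s u] sP zero by (auto simp: mem_dual_poly_iff)
  obtain e' where e': "e' > 0" "\<forall>k. 0 \<le> (s + e' *\<^sub>R (- u)) $ k"
    using nonneg_small_step[of s "- u"] sP zero by (auto simp: mem_dual_poly_iff)
  have a: "s + e *\<^sub>R u \<in> dual_poly D"
    using sP e ker
    by (simp add: mem_dual_poly_iff matrix_vector_right_distrib matrix_vector_mult_scaleR)
  have b: "s + (- e') *\<^sub>R u \<in> dual_poly D"
    using sP e' ker
    by (simp add: mem_dual_poly_iff matrix_vector_right_distrib matrix_vector_mult_scaleR
        del: scaleR_minus_left)
  have "s \<in> open_segment (s + e *\<^sub>R u) (s + (- e') *\<^sub>R u)"
    unfolding in_segment
  proof (intro conjI exI[of _ "e / (e + e')"])
    show "s + e *\<^sub>R u \<noteq> s + (- e') *\<^sub>R u"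
      using e(1) e'(1) u0 by (simp add: eq_neg_iff_add_eq_0 flip: scaleR_left.add)
    show "0 < e / (e + e')" "e / (e + e') < 1" using e(1) e'(1) by auto
    have "(1 - e / (e + e')) * e - e / (e + e') * e' = 0"
      using e(1) e'(1) by (simp add: field_simps)
    moreover have "(1 - r) *\<^sub>R (s + e *\<^sub>R u) + r *\<^sub>R (s + (- e') *\<^sub>R u)
        = s + ((1 - r) * e - r * e') *\<^sub>R u" for r
      by (simp add: algebra_simps)
    ultimately show "s = (1 - e / (e + e')) *\<^sub>R (s + e *\<^sub>R u) + (e / (e + e')) *\<^sub>R (s + (- e') *\<^sub>R u)"
      by simp
  qed
  then show False using ext a b by (auto simp: extreme_point_of_def)
qed

lemma finite_dual_vertices:
  fixes D :: "('k::finite, 'p::finite, 'n::finite, 'm::finite, 'q::finite, 't::finite) epg_data"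
  shows "finite (dual_vertices D)"
proof (rule inj_on_finite[of supp _ UNIV])
  \<comment> \<open>two vertices with the same support differ by a kernel direction on that support\<close>
  show "inj_on supp (dual_vertices D)"
  proof (rule inj_onI)
    fix s s' assume v: "s \<in> dual_vertices D" "s' \<in> dual_vertices D" and eq: "supp s = supp s'"
    then have "s \<in> dual_poly D" "s' \<in> dual_poly D"
      by (auto simp: dual_vertices_def extreme_point_of_def)
    then have "transpose (recC D) *v (s - s') = 0"
      by (simp add: mem_dual_poly_iff matrix_vector_mult_diff_distrib)
    moreover have "supp (s - s') \<subseteq> supp s"
      using eq by (auto simp: supp_def set_eq_iff)
    ultimately show "s = s'" using vertex_kernel_trivial[OF v(1)] by fastforce
  qed
qed auto


section \<open>Existence of optimal dual vertices\<close>

text \<open>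
  A point that is not a vertex lies inside a segment, whose direction lives on the support of the
  point. Following it in the non-decreasing sense until a component vanishes shrinks the support;
  if the objective grows along it, boundedness forces some component to vanish, and if the
  objective is constant along it, one of the two senses makes a component decrease to zero.
\<close>

lemma vertex_dominates:
  fixes D :: "('k::finite, 'p::finite, 'n::finite, 'm::finite, 'q::finite, 't::finite) epg_data"
  assumes bound: "\<And>z. z \<in> dual_poly D \<Longrightarrow> d \<bullet> z \<le> B"
    and z: "z \<in> dual_poly D"
  shows "\<exists>s\<in>dual_vertices D. d \<bullet> z \<le> d \<bullet> s"
  using z
proof (induction "card (supp z)" arbitrary: z rule: less_induct)
  case less
  show ?case
  proof (cases "z extreme_point_of dual_poly D")
    case True
    then show ?thesis by (auto simp: dual_vertices_def)
  next
    case False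
    then obtain a b where ab: "a \<in> dual_poly D" "b \<in> dual_poly D" "z \<in> open_segment a b"
      using less.prems by (auto simp: extreme_point_of_def)
    then obtain r where r: "0 < r" "r < 1" "z = (1 - r) *\<^sub>R a + r *\<^sub>R b" and "a \<noteq> b"
      by (auto simp: in_segment)
    define good where "good u \<longleftrightarrow> u \<noteq> 0 \<and> transpose (recC D) *v u = 0 \<and> supp u \<subseteq> supp z" for u
    have ab_zero: "a $ k = 0 \<and> b $ k = 0" if "z $ k = 0" for k
    proof -
      have "0 \<le> a $ k" "0 \<le> b $ k" using ab by (auto simp: mem_dual_poly_iff)
      moreover have "(1 - r) * a $ k + r * b $ k = 0" using that r by simp
      ultimately show ?thesis using r(1,2)
        by (metis add_nonneg_eq_0_iff diff_gt_0_iff_gt less_eq_real_def mult_eq_0_iff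
            mult_nonneg_nonneg order_less_irrefl)
    qed
    have "good (b - a)"
      using \<open>a \<noteq> b\<close> ab ab_zero
      by (auto simp: good_def mem_dual_poly_iff matrix_vector_mult_diff_distrib supp_def)
    moreover have good_minus: "good (- u)" if "good u" for u
      using that linear_neg[OF matrix_vector_mul_linear, of "transpose (recC D)" u]
      by (auto simp: good_def supp_def)
    ultimately obtain u where u: "good u" "0 \<le> d \<bullet> u"
      by (metis inner_minus_right linorder_le_cases neg_0_le_iff_le)
    have line: "transpose (recC D) *v (z + t *\<^sub>R v) = recb D" if "good v" for t v
      using that less.prems
      by (simp add: good_def mem_dual_poly_iff matrix_vector_right_distrib matrix_vector_mult_scaleR)
    have "\<exists>v. good v \<and> 0 \<le> d \<bullet> v \<and> (\<exists>k. v $ k < 0)"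
    proof (cases "\<exists>k. u $ k < 0")
      case True
      then show ?thesis using u by blast
    next
      case False
      then have nn: "\<And>k. 0 \<le> u $ k" by (simp add: not_less)
      have "d \<bullet> u = 0"
      proof (rule ccontr)
        assume "d \<bullet> u \<noteq> 0"
        then have pos: "0 < d \<bullet> u" using u by simp
        define t where "t = (\<bar>B - d \<bullet> z\<bar> + 1) / (d \<bullet> u)"
        have "0 \<le> t" using pos by (simp add: t_def)
        then have "z + t *\<^sub>R u \<in> dual_poly D"
          using line[OF u(1)] nn less.prems by (simp add: mem_dual_poly_iff)
        from bound[OF this] have "d \<bullet> z + t * (d \<bullet> u) \<le> B" by (simp add: inner_add_right)
        then show False using pos by (simp add: t_def)
      qed
      moreover obtain k where "u $ k \<noteq> 0"
        using u(1) by (auto simp: good_def vec_eq_iff)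
      then have "(- u) $ k < 0" using nn[of k] by simp
      ultimately show ?thesis using good_minus[OF u(1)] by (metis inner_minus_right neg_0_le_iff_le order_refl)
    qed
    then obtain v where v: "good v" "0 \<le> d \<bullet> v" "{k. v $ k < 0} \<noteq> {}" by auto
    define q where "q k = z $ k / (- v $ k)" for k
    obtain k0 where k0: "v $ k0 < 0" and q_min: "\<And>k. v $ k < 0 \<Longrightarrow> q k0 \<le> q k"
      using ex_is_arg_min_if_finite[OF _ v(3), of q] by (auto simp: is_arg_min_linorder)
    have z_nn: "\<And>k. 0 \<le> z $ k" using less.prems by (simp add: mem_dual_poly_iff)
    then have q_nn: "0 \<le> q k0" using k0 by (simp add: q_def divide_nonneg_neg)
    define y where "y = z + q k0 *\<^sub>R v"
    have "0 \<le> y $ k" for k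
    proof (cases "v $ k < 0")
      case True
      from q_min[OF this] have "q k0 * (- v $ k) \<le> z $ k"
        using True by (simp add: q_def[of k] field_simps)
      then show ?thesis by (simp add: y_def)
    next
      case False
      then show ?thesis using z_nn[of k] q_nn by (simp add: y_def)
    qed
    then have yP: "y \<in> dual_poly D" using line[OF v(1)] by (simp add: mem_dual_poly_iff y_def)
    have "y $ k0 = 0" using k0 by (simp add: y_def q_def)
    moreover have "k0 \<in> supp z" using v(1) k0 by (auto simp: good_def supp_def subset_iff)
    moreover have "supp y \<subseteq> supp z" using v(1) by (auto simp: good_def supp_def y_def)
    ultimately have "supp y \<subset> supp z" by (auto simp: supp_def)
    then have "card (supp y) < card (supp z)" by (intro psubset_card_mono) auto
    from less.hyps[OF this yP] obtain s where "s \<in> dual_vertices D" "d \<bullet> y \<le> d \<bullet> s" by blast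
    moreover have "d \<bullet> z \<le> d \<bullet> y" using q_nn v(2) by (simp add: y_def inner_add_right)
    ultimately show ?thesis using order_trans by blast
  qed
qed

lemma optimal_vertex_exists:
  fixes D :: "('k::finite, 'p::finite, 'n::finite, 'm::finite, 'q::finite, 't::finite) epg_data"
  assumes "dual_poly D \<noteq> {}" and bound: "\<And>z. z \<in> dual_poly D \<Longrightarrow> d \<bullet> z \<le> B"
  shows "\<exists>s\<in>dual_vertices D. is_arg_max (\<lambda>z. d \<bullet> z) (\<lambda>z. z \<in> dual_poly D) s"
proof -
  have "dual_vertices D \<noteq> {}" using assms vertex_dominates[of D d B] by blast
  then obtain s where s: "s \<in> dual_vertices D" "\<And>s'. s' \<in> dual_vertices D \<Longrightarrow> d \<bullet> s' \<le> d \<bullet> s"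
    using ex_is_arg_min_if_finite[OF finite_dual_vertices, of D "\<lambda>z. - (d \<bullet> z)"]
    by (auto simp: is_arg_min_linorder)
  moreover have "s \<in> dual_poly D"
    using s(1) by (simp add: dual_vertices_def extreme_point_of_def)
  moreover have "d \<bullet> z \<le> d \<bullet> s" if "z \<in> dual_poly D" for z
    using vertex_dominates[of D d B, OF bound that] s(2) by fastforce
  ultimately show ?thesis by (auto simp: is_arg_max_linorder)
qed


section \<open>Basic recourse solutions\<close>

lemma mult_matrix_inv_right:
  assumes "invertible A"
  shows "A ** matrix_inv A = mat 1"
  using assms someI_ex[of "\<lambda>B. A ** B = mat 1 \<and> B ** A = mat 1"]
  unfolding invertible_def matrix_inv_def by blast

lemma bij_betw_row_enum:
  assumes "card J = CARD('n::finite)"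
  shows "bij_betw (row_enum J :: 'n \<Rightarrow> 'm::finite) UNIV J"
proof -
  have "\<exists>\<sigma> :: 'n \<Rightarrow> 'm. bij_betw \<sigma> UNIV J"
    by (intro finite_same_card_bij) (use assms in auto)
  then show ?thesis unfolding row_enum_def by (rule someI_ex)
qed

lemma row_submatrix_extend_by_zero:
  fixes C :: "real^'n^'m"
  assumes card: "card J = CARD('n)"
  shows "\<exists>u. supp u \<subseteq> J \<and> subvector u J = v \<and> transpose C *v u = transpose (row_submatrix C J) *v v"
proof -
  let ?e = "row_enum J :: 'n \<Rightarrow> 'm"
  have bij: "bij_betw ?e UNIV J" by (rule bij_betw_row_enum[OF card])
  define u :: "real^'m" where "u = (\<chi> k. if k \<in> J then v $ the_inv_into UNIV ?e k else 0)"
  have mem: "?e i \<in> J" for i using bij by (auto simp: bij_betw_def)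
  have u_e: "u $ ?e i = v $ i" for i
    using bij mem[of i] by (simp add: u_def the_inv_into_f_f bij_betw_def)
  have "transpose C *v u = transpose (row_submatrix C J) *v v"
  proof (simp add: vec_eq_iff matrix_vector_mult_def transpose_def row_submatrix_def, intro allI)
    fix j
    have "(\<Sum>k\<in>UNIV. C $ k $ j * u $ k) = (\<Sum>k\<in>J. C $ k $ j * u $ k)"
      by (intro sum.mono_neutral_right) (auto simp: u_def)
    also have "\<dots> = (\<Sum>i\<in>UNIV. C $ ?e i $ j * u $ ?e i)"
      by (rule sum.reindex_bij_betw[OF bij, symmetric])
    finally show "(\<Sum>k\<in>UNIV. C $ k $ j * u $ k) = (\<Sum>i\<in>UNIV. C $ ?e i $ j * v $ i)"
      by (simp add: u_e)
  qed
  moreover have "supp u \<subseteq> J" by (auto simp: supp_def u_def)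
  moreover have "subvector u J = v" by (simp add: subvector_def vec_eq_iff u_e)
  ultimately show ?thesis by blast
qed

lemma invertible_row_submatrix:
  fixes D :: "('k::finite, 'p::finite, 'n::finite, 'm::finite, 'q::finite, 't::finite) epg_data"
  assumes s: "s \<in> dual_vertices D" and card: "card (supp s) = CARD('n)"
  shows "invertible (row_submatrix (recC D) (supp s))"
proof -
  let ?M = "row_submatrix (recC D) (supp s)"
  have "v = 0" if v: "transpose ?M *v v = 0" for v
  proof -
    obtain u where u: "supp u \<subseteq> supp s" "subvector u (supp s) = v"
        "transpose (recC D) *v u = transpose ?M *v v"
      using row_submatrix_extend_by_zero[OF card] by blast
    then have "u = 0" using vertex_kernel_trivial[OF s] v by simp
    then show ?thesis using u(2) by (simp add: subvector_def vec_eq_iff)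
  qed
  then have "invertible (transpose ?M)"
    by (simp add: invertible_left_inverse matrix_left_invertible_ker)
  then show ?thesis using transpose_invertible by fastforce
qed

lemma basic_sol_tight:
  fixes D :: "('k::finite, 'p::finite, 'n::finite, 'm::finite, 'q::finite, 't::finite) epg_data"
  assumes s: "s \<in> dual_vertices D" and card: "card (supp s) = CARD('n)" and k: "k \<in> supp s"
  shows "recC D $ k \<bullet> basic_sol D x1 s \<xi> = rhs D \<xi> x1 $ k"
proof -
  let ?M = "row_submatrix (recC D) (supp s)"
  obtain i where i: "k = (row_enum (supp s) :: 'n \<Rightarrow> 'm) i"
    using bij_betw_row_enum[OF card] k by (auto simp: bij_betw_def)
  have "?M *v basic_sol D x1 s \<xi> = subvector (rhs D \<xi> x1) (supp s)"
    by (simp add: basic_sol_def matrix_vector_mul_assoc mult_matrix_inv_right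
        invertible_row_submatrix[OF s card])
  then have "(?M *v basic_sol D x1 s \<xi>) $ i = subvector (rhs D \<xi> x1) (supp s) $ i" by simp
  then show ?thesis
    by (simp add: i row_submatrix_def subvector_def matrix_vector_mul_component)
qed

lemma basic_sol_value:
  fixes D :: "('k::finite, 'p::finite, 'n::finite, 'm::finite, 'q::finite, 't::finite) epg_data"
  assumes s: "s \<in> dual_vertices D" and card: "card (supp s) = CARD('n)"
  shows "recb D \<bullet> basic_sol D x1 s \<xi> = rhs D \<xi> x1 \<bullet> s"
proof -
  let ?x = "basic_sol D x1 s \<xi>"
  have "transpose (recC D) *v s = recb D"
    using s by (simp add: dual_vertices_def extreme_point_of_def mem_dual_poly_iff)
  then have "recb D \<bullet> ?x = (recC D *v ?x) \<bullet> s"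
    by (metis inner_commute inner_constraint_dual)
  also have "\<dots> = rhs D \<xi> x1 \<bullet> s"
    unfolding inner_vec_def
    using basic_sol_tight[OF s card, of _ x1 \<xi>]
    by (intro sum.cong) (auto simp: supp_def matrix_vector_mul_component)
  finally show ?thesis .
qed

text \<open>
  A simplex pivot that brings row \<open>k\<close> into the basis: the rows in the support of the vertex form
  a basis, so row \<open>k\<close> can be compensated on that support. The objective changes at the rate
  \<open>row_excess\<close>, and the step length is positive because the vertex is nondegenerate.
\<close>

lemma positive_excess_improves:
  fixes D :: "('k::finite, 'p::finite, 'n::finite, 'm::finite, 'q::finite, 't::finite) epg_data"
  assumes s: "s \<in> dual_vertices D" and card: "card (supp s) = CARD('n)"
    and k: "k \<notin> supp s" and pos: "0 < row_excess D x1 s k \<xi>"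
  shows "\<exists>z\<in>dual_poly D. rhs D \<xi> x1 \<bullet> s < rhs D \<xi> x1 \<bullet> z"
proof -
  let ?C = "recC D" and ?M = "row_submatrix (recC D) (supp s)"
  let ?x = "basic_sol D x1 s \<xi>" and ?d = "rhs D \<xi> x1"
  have sP: "s \<in> dual_poly D" using s by (simp add: dual_vertices_def extreme_point_of_def)
  have "transpose ?M *v (matrix_inv (transpose ?M) *v ?C $ k) = ?C $ k"
    using invertible_row_submatrix[OF s card]
    by (simp add: matrix_vector_mul_assoc mult_matrix_inv_right transpose_invertible)
  then obtain u0 where u0: "supp u0 \<subseteq> supp s" "transpose ?C *v u0 = ?C $ k"
    using row_submatrix_extend_by_zero[OF card, of "matrix_inv (transpose ?M) *v ?C $ k" ?C] by auto
  define u where "u = axis k 1 - u0"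
  have "transpose ?C *v axis k 1 = ?C $ k"
    by (simp add: matrix_vector_mult_basis column_def transpose_def vec_eq_iff)
  then have ker: "transpose ?C *v u = 0"
    using u0(2) by (simp add: u_def matrix_vector_mult_diff_distrib)
  have uk: "u $ k = 1" and u_supp: "\<And>j. j \<notin> supp s \<Longrightarrow> j \<noteq> k \<Longrightarrow> u $ j = 0"
    using u0(1) k by (auto simp: u_def axis_def supp_def)
  \<comment> \<open>in \<open>d - C x\<close> the rows of the support vanish, so only row \<open>k\<close> contributes\<close>
  have "?d \<bullet> u = (?d - ?C *v ?x) \<bullet> u"
    using inner_constraint_dual[of ?x ?C u] ker by (simp add: inner_diff_left)
  also have "\<dots> = (\<Sum>j\<in>UNIV. (?d $ j - ?C $ j \<bullet> ?x) * u $ j)"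
    by (simp add: inner_vec_def matrix_vector_mul_component)
  also have "\<dots> = (\<Sum>j\<in>{k}. (?d $ j - ?C $ j \<bullet> ?x) * u $ j)"
  proof (intro sum.mono_neutral_right ballI)
    fix j assume "j \<in> UNIV - {k}"
    then show "(?d $ j - ?C $ j \<bullet> ?x) * u $ j = 0"
      using u_supp[of j] basic_sol_tight[OF s card, of j x1 \<xi>] by (cases "j \<in> supp s") auto
  qed auto
  finally have rate: "?d \<bullet> u = row_excess D x1 s k \<xi>"
    using uk by (simp add: row_excess_def)
  obtain e where e: "e > 0" "\<forall>j. 0 \<le> (s + e *\<^sub>R u) $ j"
  proof -
    have "0 \<le> u $ j" if "s $ j = 0" for j
      using u_supp[of j] uk that by (cases "j = k") (auto simp: supp_def)
    then show ?thesis
      using nonneg_small_step[of s u] sP that by (auto simp: mem_dual_poly_iff)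
  qed
  have "s + e *\<^sub>R u \<in> dual_poly D"
    using sP e ker
    by (simp add: mem_dual_poly_iff matrix_vector_right_distrib matrix_vector_mult_scaleR)
  moreover have "?d \<bullet> s < ?d \<bullet> (s + e *\<^sub>R u)"
    using e(1) rate pos by (simp add: inner_add_right)
  ultimately show ?thesis by blast
qed

text \<open>Weak duality certifies a primal feasible basic solution, since it has the value of its vertex.\<close>

lemma recourse_value_eq_vertex_value:
  fixes D :: "('k::finite, 'p::finite, 'n::finite, 'm::finite, 'q::finite, 't::finite) epg_data"
  assumes s: "s \<in> dual_vertices D" and card: "card (supp s) = CARD('n)"
    and excess: "\<And>k. k \<notin> supp s \<Longrightarrow> row_excess D x1 s k \<xi> \<le> 0"
  shows "recourse_value D x1 \<xi> = rhs D \<xi> x1 \<bullet> s"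
  unfolding recourse_value_def
proof (rule Least_equality)
  let ?x = "basic_sol D x1 s \<xi>"
  have "rhs D \<xi> x1 $ k \<le> (recC D *v ?x) $ k" for k
    using excess[of k] basic_sol_tight[OF s card, of k x1 \<xi>]
    by (cases "k \<in> supp s") (auto simp: row_excess_def matrix_vector_mul_component)
  then show "\<exists>x2. rhs D \<xi> x1 \<le> recC D *v x2 \<and> rhs D \<xi> x1 \<bullet> s = recb D \<bullet> x2"
    using basic_sol_value[OF s card, of x1 \<xi>] by (metis less_eq_vec_def)
next
  fix v assume "\<exists>x2. rhs D \<xi> x1 \<le> recC D *v x2 \<and> v = recb D \<bullet> x2"
  then obtain x2 where x2: "rhs D \<xi> x1 \<le> recC D *v x2" "v = recb D \<bullet> x2" by blast
  have sP: "s \<in> dual_poly D" using s by (simp add: dual_vertices_def extreme_point_of_def)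
  have "rhs D \<xi> x1 \<bullet> s \<le> (recC D *v x2) \<bullet> s"
    unfolding inner_vec_def using x2(1) sP
    by (intro sum_mono) (simp add: less_eq_vec_def mem_dual_poly_iff mult_right_mono)
  also have "\<dots> = v"
    using sP x2(2) inner_constraint_dual[of x2 "recC D" s]
    by (simp add: mem_dual_poly_iff inner_commute)
  finally show "rhs D \<xi> x1 \<bullet> s \<le> v" .
qed


section \<open>Dominance cells and audits\<close>

lemma continuous_on_rhs:
  "continuous_on S (\<lambda>\<xi>. rhs D \<xi> x1)"
  unfolding rhs_def
  by (intro continuous_intros linear_continuous_on_compose[OF continuous_on_id]
      matrix_vector_mul_linear)

lemma closedin_cell:
  "closedin (top_of_set (Xi D)) (cell D x1 T s)"
proof -
  have "closedin (top_of_set (Xi D)) (Xi D \<inter> (\<Inter>s'\<in>T. {\<xi> \<in> Xi D. rhs D \<xi> x1 \<bullet> s' \<le> rhs D \<xi> x1 \<bullet> s}))"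
  proof (cases "T = {}")
    case False
    have "closedin (top_of_set (Xi D)) {\<xi> \<in> Xi D. rhs D \<xi> x1 \<bullet> s' \<le> rhs D \<xi> x1 \<bullet> s}" for s'
    proof -
      have "continuous_on (Xi D) (\<lambda>\<xi>. rhs D \<xi> x1 \<bullet> s - rhs D \<xi> x1 \<bullet> s')"
        by (intro continuous_intros continuous_on_rhs)
      from continuous_closedin_preimage[OF this closed_atLeast[of 0]] show ?thesis
        by (simp add: vimage_def Int_def)
    qed
    then show ?thesis using False by (intro closedin_Int closedin_Inter) auto
  qed simp
  also have "Xi D \<inter> (\<Inter>s'\<in>T. {\<xi> \<in> Xi D. rhs D \<xi> x1 \<bullet> s' \<le> rhs D \<xi> x1 \<bullet> s}) = cell D x1 T s"
    by (auto simp: cell_def)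
  finally show ?thesis .
qed

lemma continuous_on_row_excess:
  fixes D :: "('k::finite, 'p::finite, 'n::finite, 'm::finite, 'q::finite, 't::finite) epg_data"
  shows "continuous_on S (row_excess D x1 s k)"
proof -
  have "continuous_on S (\<lambda>\<xi>. subvector (rhs D \<xi> x1) (supp s) :: real^'n)"
    unfolding subvector_def by (intro continuous_intros continuous_on_rhs)
  then have "continuous_on S (basic_sol D x1 s)"
    unfolding basic_sol_def
    by (rule bounded_linear.continuous_on[OF matrix_vector_mul_bounded_linear])
  then show ?thesis
    unfolding row_excess_def by (intro continuous_intros continuous_on_rhs)
qed

lemma audit_attained:
  assumes "compact (Xi D)" and "cell D x1 T s \<noteq> {}"
  shows "\<exists>\<xi>. is_arg_max (row_excess D x1 s k) (\<lambda>\<xi>. \<xi> \<in> cell D x1 T s) \<xi>"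
proof -
  have "compact (cell D x1 T s)" using assms(1) closedin_cell by (rule closedin_compact)
  from continuous_attains_sup[OF this assms(2) continuous_on_row_excess[of _ D x1 s k]]
  show ?thesis by (auto simp: is_arg_max_linorder)
qed

lemma audit_eq_row_excess:
  assumes "is_arg_max (row_excess D x1 s k) (\<lambda>\<xi>. \<xi> \<in> cell D x1 T s) \<xi>"
  shows "audit D x1 T s k = row_excess D x1 s k \<xi>"
  unfolding audit_def using assms by (intro Greatest_equality) (auto simp: is_arg_max_linorder)

lemma row_excess_le_audit:
  assumes "compact (Xi D)" and "\<xi> \<in> cell D x1 T s"
  shows "row_excess D x1 s k \<xi> \<le> audit D x1 T s k"
  using audit_attained[of D x1 T s k] assms audit_eq_row_excess[of D x1 s k T]
  by (force simp: is_arg_max_linorder)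

lemma cells_cover:
  fixes D :: "('k::finite, 'p::finite, 'n::finite, 'm::finite, 'q::finite, 't::finite) epg_data"
  assumes "finite T" "T \<noteq> {}" "\<xi> \<in> Xi D"
  shows "\<exists>s\<in>T. \<xi> \<in> cell D x1 T s"
  using ex_is_arg_min_if_finite[OF assms(1,2), of "\<lambda>s. - (rhs D \<xi> x1 \<bullet> s)"] assms(3)
  by (auto simp: is_arg_min_linorder cell_def)

lemma finite_union_empty_interior:
  assumes "finite F" "\<And>S. S \<in> F \<Longrightarrow> closedin X S" "\<And>S. S \<in> F \<Longrightarrow> X interior_of S = {}"
  shows "X interior_of \<Union>F = {}"
  using assms
proof (induction F rule: finite_induct)
  case (insert S F)
  then show ?case
    using interior_of_union_eq_empty[of X S "\<Union>F"] by (simp add: closedin_Union)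
qed simp

text \<open>
  The deleted cells are finitely many closed sets without interior, so the remaining cells are
  dense in the uncertainty set; being closed, they still cover it.
\<close>

lemma pruned_cells_cover:
  fixes D :: "('k::finite, 'p::finite, 'n::finite, 'm::finite, 'q::finite, 't::finite) epg_data"
  assumes fin: "finite T" and "T \<noteq> {}" and \<xi>: "\<xi> \<in> Xi D"
  shows "\<exists>s\<in>prune D x1 T. \<xi> \<in> cell D x1 T s"
proof (rule ccontr)
  let ?X = "top_of_set (Xi D)"
  let ?P = "\<Union>(cell D x1 T ` prune D x1 T)" and ?Q = "\<Union>(cell D x1 T ` (T - prune D x1 T))"
  assume "\<not> ?thesis"
  then have "\<xi> \<in> Xi D - ?P" using \<xi> by auto
  moreover have "openin ?X (Xi D - ?P)"
  proof -
    have "finite (prune D x1 T)" using fin by (simp add: prune_def)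
    then have "closedin ?X ?P" by (intro closedin_Union) (auto simp: closedin_cell)
    then show ?thesis by (simp add: closedin_def)
  qed
  moreover have "Xi D - ?P \<subseteq> ?Q"
    using cells_cover[OF fin \<open>T \<noteq> {}\<close>, of _ D x1] by blast
  ultimately have "\<xi> \<in> ?X interior_of ?Q" by (auto simp: interior_of_def)
  moreover have "?X interior_of ?Q = {}"
    using fin by (intro finite_union_empty_interior) (auto simp: closedin_cell prune_def)
  ultimately show False by simp
qed


section \<open>Runs of the two algorithms\<close>

lemma epgo_iterate_vertices:
  assumes "epgo_iterate D \<epsilon>disc \<epsilon>obj S1 T" and "S1 \<subseteq> dual_vertices D"
  shows "T \<subseteq> dual_vertices D"
  using assms by induction (auto simp: approx_separation_def separation_def)

lemma epgo_output_vertices: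
  assumes "epgo_output D \<epsilon>disc \<epsilon>obj S1 x1 \<theta> S'" and "S1 \<subseteq> dual_vertices D"
  shows "S' \<subseteq> dual_vertices D"
proof -
  from assms(1) obtain T where T: "epgo_iterate D \<epsilon>disc \<epsilon>obj S1 T" "(deletion D)\<^sup>*\<^sup>* T S'"
    by (auto simp: epgo_output_def)
  from T(2) have "S' \<subseteq> T" by induction (auto simp: deletion_def)
  then show ?thesis using epgo_iterate_vertices[OF T(1) assms(2)] by blast
qed

text \<open>
  The exact separation that ends a run attains a finite maximal violation, so the recourse dual
  is bounded in every scenario.
\<close>

lemma epgo_output_dual_bounded:
  assumes "epgo_output D \<epsilon>disc \<epsilon>obj S1 x1 \<theta> S'" and \<xi>: "\<xi> \<in> Xi D"
  shows "\<exists>B. \<forall>z\<in>dual_poly D. rhs D \<xi> x1 \<bullet> z \<le> B"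
proof -
  from assms(1) obtain V s where "separation D (Xi D) (x1, \<theta>) V s"
    by (auto simp: epgo_output_def)
  then obtain l \<xi>' where
    max: "is_arg_max (violation D (x1, \<theta>)) (\<lambda>u. u \<in> {1..nphi D} \<times> Xi D \<times> dual_poly D) (l, \<xi>', s)"
    by (auto simp: separation_def)
  have "rhs D \<xi> x1 \<bullet> z \<le> violation D (x1, \<theta>) (l, \<xi>', s) + phi D l \<theta> \<xi>"
    if "z \<in> dual_poly D" for z
  proof -
    have "violation D (x1, \<theta>) (l, \<xi>, z) \<le> violation D (x1, \<theta>) (l, \<xi>', s)"
      using max that \<xi> unfolding is_arg_max_linorder by auto
    then show ?thesis by (simp add: violation_def)
  qed
  then show ?thesis by blast
qed

lemma epgv_reachable_vertices:
  assumes "(epgv_step D x1 \<epsilon>aud)\<^sup>*\<^sup>* S' T" and "S' \<subseteq> dual_vertices D"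
  shows "S' \<subseteq> T \<and> T \<subseteq> dual_vertices D"
  using assms by induction (auto simp: epgv_step_def)

text \<open>
  If the added vertex were already present, the audited vertex, which dominates it on its cell,
  would be dual optimal at the witness and could not be improved by a pivot.
\<close>

lemma epgv_step_adds_vertex:
  fixes D :: "('k::finite, 'p::finite, 'n::finite, 'm::finite, 'q::finite, 't::finite) epg_data"
  assumes step: "epgv_step D x1 \<epsilon>aud T T'" and "0 \<le> \<epsilon>aud"
    and T: "T \<subseteq> dual_vertices D"
    and card: "\<forall>s\<in>dual_vertices D. card (supp s) = CARD('n)"
  shows "T \<subset> T' \<and> T' \<subseteq> dual_vertices D"
proof -
  from step obtain s k \<xi> snew where
    fails: "audit_fails D x1 \<epsilon>aud T s k" and
    wit: "is_arg_max (row_excess D x1 s k) (\<lambda>\<xi>. \<xi> \<in> cell D x1 T s) \<xi>" and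
    snew: "snew \<in> dual_vertices D" and
    opt: "is_arg_max (\<lambda>z. rhs D \<xi> x1 \<bullet> z) (\<lambda>z. z \<in> dual_poly D) snew" and
    T': "T' = insert snew T"
    by (auto simp: epgv_step_def)
  have s: "s \<in> dual_vertices D" "s \<in> T" "k \<notin> supp s" using fails T by (auto simp: audit_fails_def)
  have "0 < row_excess D x1 s k \<xi>"
    using fails \<open>0 \<le> \<epsilon>aud\<close> audit_eq_row_excess[OF wit] by (simp add: audit_fails_def)
  then obtain z where z: "z \<in> dual_poly D" "rhs D \<xi> x1 \<bullet> s < rhs D \<xi> x1 \<bullet> z"
    using positive_excess_improves[OF s(1) _ s(3)] card s(1) by blast
  have "snew \<notin> T"
  proof
    assume "snew \<in> T"
    then have "rhs D \<xi> x1 \<bullet> snew \<le> rhs D \<xi> x1 \<bullet> s"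
      using wit by (auto simp: is_arg_max_def cell_def)
    moreover have "rhs D \<xi> x1 \<bullet> z \<le> rhs D \<xi> x1 \<bullet> snew"
      using opt z(1) by (simp add: is_arg_max_linorder)
    ultimately show False using z(2) by simp
  qed
  then show ?thesis using T snew T' by auto
qed

lemma no_infinite_epgv_run:
  fixes D :: "('k::finite, 'p::finite, 'n::finite, 'm::finite, 'q::finite, 't::finite) epg_data"
  assumes "0 \<le> \<epsilon>aud" and S': "S' \<subseteq> dual_vertices D"
    and card: "\<forall>s\<in>dual_vertices D. card (supp s) = CARD('n)"
  shows "\<not> (\<exists>f. f 0 = S' \<and> (\<forall>i::nat. epgv_step D x1 \<epsilon>aud (f i) (f (Suc i))))"
proof
  assume "\<exists>f. f 0 = S' \<and> (\<forall>i::nat. epgv_step D x1 \<epsilon>aud (f i) (f (Suc i)))"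
  then obtain f where f: "f 0 = S'" "\<And>i. epgv_step D x1 \<epsilon>aud (f i) (f (Suc i))" by blast
  have grow: "f i \<subseteq> dual_vertices D \<and> i \<le> card (f i)" for i
  proof (induction i)
    case 0
    then show ?case using f(1) S' by simp
  next
    case (Suc i)
    then have "f i \<subset> f (Suc i)" "f (Suc i) \<subseteq> dual_vertices D"
      using epgv_step_adds_vertex[OF f(2) assms(1) _ card] by auto
    moreover from this have "card (f i) < card (f (Suc i))"
      by (meson finite_dual_vertices finite_subset psubset_card_mono)
    ultimately show ?case using Suc by simp
  qed
  have "card (f i) \<le> card (dual_vertices D)" for i
    using grow by (intro card_mono finite_dual_vertices) auto
  then show False using grow by (meson Suc_n_not_le_n order_trans)
qed

lemma epgv_step_possible:
  assumes "compact (Xi D)" and "dual_poly D \<noteq> {}"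
    and bounded: "\<And>\<xi>. \<xi> \<in> Xi D \<Longrightarrow> \<exists>B. \<forall>z\<in>dual_poly D. rhs D \<xi> x1 \<bullet> z \<le> B"
    and fails: "audit_fails D x1 \<epsilon>aud T s k"
  shows "\<exists>T'. epgv_step D x1 \<epsilon>aud T T'"
proof -
  obtain \<xi> where wit: "is_arg_max (row_excess D x1 s k) (\<lambda>\<xi>. \<xi> \<in> cell D x1 T s) \<xi>"
    using audit_attained[OF assms(1), of x1 T s k] fails unfolding audit_fails_def by blast
  then have "\<xi> \<in> Xi D" by (auto simp: is_arg_max_def cell_def)
  then obtain B where "\<forall>z\<in>dual_poly D. rhs D \<xi> x1 \<bullet> z \<le> B" using bounded by blast
  then obtain snew where "snew \<in> dual_vertices D"
      "is_arg_max (\<lambda>z. rhs D \<xi> x1 \<bullet> z) (\<lambda>z. z \<in> dual_poly D) snew"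
    using optimal_vertex_exists[OF assms(2)] by blast
  with wit fails show ?thesis unfolding epgv_step_def by blast
qed

lemma prune_value_complete:
  fixes D :: "('k::finite, 'p::finite, 'n::finite, 'm::finite, 'q::finite, 't::finite) epg_data"
  assumes "compact (Xi D)" and T: "T \<subseteq> dual_vertices D" "T \<noteq> {}"
    and card: "\<forall>s\<in>dual_vertices D. card (supp s) = CARD('n)"
    and pass: "\<nexists>s k. audit_fails D x1 0 T s k"
  shows "value_complete D x1 (prune D x1 T)"
  unfolding value_complete_def
proof
  fix \<xi> assume \<xi>: "\<xi> \<in> Xi D"
  have fin: "finite T" using T(1) finite_dual_vertices finite_subset by blast
  obtain s where s: "s \<in> prune D x1 T" "\<xi> \<in> cell D x1 T s"
    using pruned_cells_cover[OF fin T(2) \<xi>] by blast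
  have sub: "prune D x1 T \<subseteq> T" by (auto simp: prune_def)
  then have sv: "s \<in> T" "s \<in> dual_vertices D" using s(1) T(1) by auto
  have "row_excess D x1 s k \<xi> \<le> 0" if "k \<notin> supp s" for k
    using row_excess_le_audit[OF assms(1) s(2), of k] pass sv(1) s(2) that
    by (force simp: audit_fails_def)
  then have "recourse_value D x1 \<xi> = rhs D \<xi> x1 \<bullet> s"
    using recourse_value_eq_vertex_value[OF sv(2)] card sv(2) by blast
  moreover have "Max ((\<lambda>s. rhs D \<xi> x1 \<bullet> s) ` prune D x1 T) = rhs D \<xi> x1 \<bullet> s"
    using s sub fin by (intro Max_eqI) (auto simp: cell_def intro: finite_subset)
  ultimately show "Max ((\<lambda>s. rhs D \<xi> x1 \<bullet> s) ` prune D x1 T) = recourse_value D x1 \<xi>" by simp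
qed


section \<open>Termination and value-completeness of EPG-V\<close>

theorem theorem3:
  fixes D :: "('k::finite, 'p::finite, 'n::finite, 'm::finite, 'q::finite, 't::finite) epg_data"
    and S1 S' :: "(real^'m) set" and \<epsilon>disc \<epsilon>obj :: real
    and x1 :: "real^'p" and \<theta> :: "real^'t"
  assumes "compact (Xi D)"
    and "CARD('n) \<le> CARD('m)"
    and "dual_poly D \<noteq> {}"
    and "\<exists>y. master_solution D (dual_vertices D) y"
    and "S1 \<subseteq> dual_vertices D" and "S1 \<noteq> {}"
    and "\<epsilon>disc \<ge> 0" and "\<epsilon>obj \<ge> 0"
    and "epgo_output D \<epsilon>disc \<epsilon>obj S1 x1 \<theta> S'" and "S' \<noteq> {}"
    and "rank (recC D) = CARD('n)"
    and "\<forall>s\<in>dual_vertices D. card (supp s) = CARD('n)"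
  shows "epgv_terminates D x1 0 S' \<and>
         (\<forall>Sval. epgv_output D x1 0 S' Sval \<longrightarrow> value_complete D x1 Sval)"
proof -
  have S': "S' \<subseteq> dual_vertices D"
    using epgo_output_vertices[OF assms(9,5)] .
  have card: "\<forall>s\<in>dual_vertices D. card (supp s) = CARD('n)" by (rule assms(12))
  have "epgv_terminates D x1 0 S'"
    unfolding epgv_terminates_def
    using no_infinite_epgv_run[OF order_refl S' card]
      epgv_step_possible[OF assms(1,3) epgo_output_dual_bounded[OF assms(9)]]
    by blast
  moreover have "value_complete D x1 Sval" if out: "epgv_output D x1 0 S' Sval" for Sval
  proof -
    from out obtain T where T: "(epgv_step D x1 0)\<^sup>*\<^sup>* S' T"
        "\<nexists>s k. audit_fails D x1 0 T s k" "Sval = prune D x1 T"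
      by (auto simp: epgv_output_def)
    then show ?thesis
      using prune_value_complete[OF assms(1) _ _ card T(2)]
        epgv_reachable_vertices[OF T(1) S'] \<open>S' \<noteq> {}\<close> by auto
  qed
  ultimately show ?thesis by blast
qed

end
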